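(* Let $A\subset\mathbb{R}^2$ be a Lebesgue measurable set of positive Lebesgue measure. Then there exists a set $B\subset A$ such that $B$ avoids rational distances (i.e. for all $x,y\in B$ with $x\neq y$, the Euclidean distance $d(x,y)$ is irrational) and $B$ is full in $A$.
   Context: We work in ZFC. $d$ denotes the standard Euclidean metric on $\mathbb{R}^2$, and $\lambda^*$ denotes Lebesgue outer measure on $\mathbb{R}^2$. A set avoids rational distances (is an ARD set) if the distance between any two distinct points of it is irrational. For $B\subset A\subset\mathbb{R}^2$, the set $B$ is full in $A$ if for each Lebesgue measurable set $X\subset\mathbb{R}^2$ of positive measure we have $\lambda^*(X\cap A)=\lambda^*(X\cap B)$. *)

theory Defs
  imports "HOL-Analysis.Analysis"
begin

text \<open>On \<open>real^2\<close> the library's \<open>dist\<close> is the Euclidean metric, and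
  \<open>outer_measure_of lebesgue\<close>, the infimum of the measures of all Lebesgue measurable
  supersets, is Lebesgue outer measure.\<close>

definition avoids_rational_distances :: "(real^2) set \<Rightarrow> bool" where
  "avoids_rational_distances B \<longleftrightarrow> (\<forall>x\<in>B. \<forall>y\<in>B. x \<noteq> y \<longrightarrow> dist x y \<notin> \<rat>)"

definition full_in :: "(real^2) set \<Rightarrow> (real^2) set \<Rightarrow> bool" where
  "full_in B A \<longleftrightarrow> B \<subseteq> A \<and>
     (\<forall>X\<in>sets lebesgue. emeasure lebesgue X > 0 \<longrightarrow>
        outer_measure_of lebesgue (X \<inter> A) = outer_measure_of lebesgue (X \<inter> B))"

end

theory Submission
  imports Defs
begin

text \<open>A measurable set of positive measure contains a closed set of positive measure, so it
  suffices that \<open>B\<close> meets every closed subset of \<open>A\<close> of positive measure. There are at most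
  continuum many of these, and we pick a point in each by transfinite recursion, at irrational
  distance from the fewer than continuum many points chosen before. This is possible without CH:
  by Fubini some vertical line meets the closed set in positive linear measure, hence in continuum
  many points, while each of the fewer than continuum many forbidden circles meets that line in
  at most two points.\<close>

unbundle cardinal_syntax

section \<open>Choice by transfinite recursion\<close>

text \<open>The cardinal order \<open>|C|\<close> well-orders \<open>C\<close> so that each proper
  initial segment has cardinality below \<open>|C|\<close>. The hypothesis therefore always applies
  to the set of points chosen so far. Only the later point is chosen with regard to the earlier one,
  hence the disjunction for a relation that may fail to be symmetric.\<close>

lemma transfinite_transversal:
  assumes "\<And>K S. K \<in> C \<Longrightarrow> |S| <o |C| \<Longrightarrow> \<exists>x\<in>K. \<forall>y\<in>S. R x y"
  obtains f where "\<And>K. K \<in> C \<Longrightarrow> f K \<in> K"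
    and "\<And>K L. K \<in> C \<Longrightarrow> L \<in> C \<Longrightarrow> K \<noteq> L \<Longrightarrow> R (f K) (f L) \<or> R (f L) (f K)"
proof -
  let ?r = "|C|"
  \<comment> \<open>\<open>underS ?r K\<close> is the set of strict predecessors of
    \<open>K\<close>. The guard \<open>K \<in> C\<close> makes the condition void elsewhere, since
    the recursion produces a function on the whole type.\<close>
  let ?P = "\<lambda>f K x. K \<in> C \<longrightarrow> x \<in> K \<and> (\<forall>y\<in>f ` underS ?r K. R x y)"
  have wo: "wo_rel ?r"
    by (simp add: wo_rel_def card_of_Well_order)
  have "\<exists>f. \<forall>K. ?P f K (f K)"
  proof (rule dependent_wf_choice[of "?r - Id"])
    show "wf (?r - Id)"
      using wo by (rule wo_rel.WF)
    show "?P f K x = ?P g K x" if "\<And>z. (z, K) \<in> ?r - Id \<Longrightarrow> f z = g z" for f g K x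
      using that by (auto simp: underS_def)
    show "\<exists>x. ?P f K x" for K f
    proof (cases "K \<in> C")
      case True
      then have "|f ` underS ?r K| <o |C|"
        using card_of_underS[of ?r K] True
        by (intro ordLeq_ordLess_trans[OF card_of_image]) (simp add: Field_card_of card_of_card_order_on)
      then show ?thesis
        using assms[OF True] by blast
    qed auto
  qed
  then obtain f where f: "?P f K (f K)" for K
    by blast
  show thesis
  proof
    show "f K \<in> K" if "K \<in> C" for K
      using f that by blast
    show "R (f K) (f L) \<or> R (f L) (f K)" if "K \<in> C" "L \<in> C" "K \<noteq> L" for K L
    proof -
      have "(K, L) \<in> ?r \<or> (L, K) \<in> ?r"
        using wo_rel.TOTALS[OF wo] that by (simp add: Field_card_of)
      then have "K \<in> underS ?r L \<or> L \<in> underS ?r K"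
        using that by (auto simp: underS_def)
      then show ?thesis
        using f that by blast
    qed
  qed
qed

section \<open>Counting closed sets and points of non-null compact sets\<close>

text \<open>A closed set is recovered from the members of a countable basis that miss it, because
  their union is its complement. Numbering the basis thus codes closed sets injectively by sets of
  naturals.\<close>

lemma card_of_closed_sets_ordLeq:
  assumes "\<And>K. K \<in> C \<Longrightarrow> closed (K :: 'a::second_countable_topology set)"
  shows "|C| \<le>o |UNIV :: real set|"
proof -
  obtain B :: "'a set set" where B: "countable B" "topological_basis B"
    using ex_countable_basis by blast
  obtain e :: "'a set \<Rightarrow> nat" where e: "inj_on e B"
    using B(1) by (auto simp: countable_def)
  let ?h = "\<lambda>K. e ` {b\<in>B. b \<inter> K = {}}"
  have "inj_on ?h C"
  proof (rule inj_onI)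
    fix K L assume "K \<in> C" "L \<in> C" and eq: "?h K = ?h L"
    have eq': "{b\<in>B. b \<inter> K = {}} = {b\<in>B. b \<inter> L = {}}"
      using inj_on_image_eq_iff[OF e] eq by auto
    have "- M = \<Union>{b\<in>B. b \<inter> M = {}}" if "M \<in> C" for M
    proof -
      have "open (- M)"
        using assms that by auto
      then have "\<exists>b\<in>B. x \<in> b \<and> b \<subseteq> - M" if "x \<in> - M" for x
        using topological_basisE[OF B(2) _ that] by metis
      then show ?thesis by blast
    qed
    from this[OF \<open>K \<in> C\<close>] this[OF \<open>L \<in> C\<close>] show "K = L"
      unfolding eq' by blast
  qed
  then have "|C| \<le>o |UNIV :: nat set set|"
    by (auto simp flip: card_of_ordLeq)
  also have "|UNIV :: nat set set| =o |UNIV :: real set|"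
    using nat_sets_eqpoll_reals by (simp add: eqpoll_iff_card_of_ordIso)
  finally show ?thesis .
qed

lemma card_of_real_ordLeq_compact:
  fixes T :: "real set"
  assumes "compact T" "emeasure lborel T \<noteq> 0"
  shows "|UNIV :: real set| \<le>o |T|"
proof -
  \<comment> \<open>The distribution function of \<open>T\<close> is continuous and already attains its intermediate values on \<open>T\<close>.\<close>
  let ?g = "\<lambda>t. measure lborel (T \<inter> {..t})"
  have T: "T \<in> fmeasurable lborel" "\<And>t. T \<inter> {..t} \<in> fmeasurable lborel"
    using assms(1) by (auto intro!: fmeasurable_compact compact_Int_closed)
  define M where "M = measure lborel T"
  have "M > 0"
    using T(1) assms(2) unfolding M_def
    by (simp add: emeasure_eq_measure2 zero_less_measure_iff)
  obtain c where "T \<subseteq> cbox (- c) c"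
    using bounded_subset_cbox_symmetric[OF compact_imp_bounded[OF assms(1)]] .
  then have ab: "\<And>x. x \<in> T \<Longrightarrow> - c \<le> x \<and> x \<le> c"
    by auto
  \<comment> \<open>The extra \<open>- 1\<close> puts \<open>a\<close> strictly to the left of
    \<open>T\<close>, so that \<open>?g\<close> starts at 0. The absolute values give
    \<open>a \<le> b\<close> whatever the sign of \<open>c\<close>.\<close>
  define a where "a = - \<bar>c\<bar> - 1"
  define b where "b = \<bar>c\<bar>"
  \<comment> \<open>Between \<open>s\<close> and \<open>t\<close> the function can gain at most the
    length of \<open>{s..t}\<close>.\<close>
  have lip: "dist (?g s) (?g t) \<le> dist s t" if "s \<le> t" for s t
  proof -
    have st: "{s..t} \<in> fmeasurable lborel"
      by (rule fmeasurable_compact[OF compact_Icc])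
    have "?g t \<le> measure lborel ((T \<inter> {..s}) \<union> {s..t})"
      by (intro measure_mono_fmeasurable fmeasurable.Un fmeasurableD T st) auto
    also have "\<dots> \<le> ?g s + measure lborel {s..t}"
      by (intro measure_Un_le fmeasurableD T st)
    finally have "?g t \<le> ?g s + (t - s)"
      using that by simp
    moreover have "?g s \<le> ?g t"
      using that by (intro measure_mono_fmeasurable fmeasurableD T) auto
    ultimately show ?thesis
      using that by (simp add: dist_real_def)
  qed
  have "continuous_on {a..b} ?g"
  proof (rule lipschitz_on_continuous_on)
    show "1-lipschitz_on {a..b} ?g"
    proof (rule lipschitz_onI)
      show "dist (?g s) (?g t) \<le> 1 * dist s t" for s t
        using lip[of s t] lip[of t s] by (cases "s \<le> t") (simp_all add: dist_commute)
    qed auto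
  qed
  moreover have "?g a = 0"
  proof -
    have "T \<inter> {..a} = {}"
      using ab unfolding a_def by fastforce
    then show ?thesis by simp
  qed
  moreover have "?g b = M"
  proof -
    have "T \<inter> {..b} = T"
      using ab unfolding b_def by fastforce
    then show ?thesis by (simp only: M_def)
  qed
  moreover have "a \<le> b"
    by (simp add: a_def b_def)
  ultimately have ivt: "\<exists>t. ?g t = v" if "0 < v" "v < M" for v
    using IVT'[of ?g a v b] that by (metis less_imp_le)
  have "{0<..<M} \<subseteq> ?g ` T"
  proof
    fix v assume v: "v \<in> {0<..<M}"
    then obtain t where t: "?g t = v"
      using ivt by auto
    \<comment> \<open>Moving left from \<open>t\<close> to the last point \<open>s\<close> of
      \<open>T\<close> loses nothing of \<open>T\<close>, so \<open>?g\<close> keeps the value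
      \<open>v\<close>. Such a point exists by compactness, and positivity of \<open>v\<close>
      ensures that there is something to the left of \<open>t\<close>.\<close>
    have "T \<inter> {..t} \<noteq> {}"
    proof
      assume "T \<inter> {..t} = {}"
      then show False using t v by simp
    qed
    moreover have "compact (T \<inter> {..t})"
      using assms(1) by (intro compact_Int_closed) auto
    ultimately obtain s where s: "s \<in> T \<inter> {..t}" "\<forall>x\<in>T \<inter> {..t}. x \<le> s"
      using compact_attains_sup[of "T \<inter> {..t}"] by auto
    then have "T \<inter> {..s} = T \<inter> {..t}"
      by fastforce
    then have "v = ?g s"
      using t by simp
    then show "v \<in> ?g ` T"
      using s(1) by blast
  qed
  then have "|{0<..<M}| \<le>o |T|"
    by (rule surj_imp_ordLeq)
  moreover have "|UNIV :: real set| =o |{0<..<M}|"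
    using open_interval_eqpoll_reals[of 0 M] \<open>M > 0\<close>
    by (simp add: eqpoll_iff_card_of_ordIso ordIso_symmetric)
  ultimately show ?thesis
    by (rule ordIso_ordLeq_trans[rotated])
qed

section \<open>Fubini in the plane\<close>

text \<open>This identification carries the product measure, for which sections can be integrated,
  over to the vector type used in the theorem.\<close>

definition plane_point :: "real \<times> real \<Rightarrow> real^2" where
  "plane_point p = vector [fst p, snd p]"

lemma plane_point_nth [simp]: "plane_point p $ 1 = fst p" "plane_point p $ 2 = snd p"
  by (auto simp: plane_point_def)

lemma continuous_on_plane_point [continuous_intros]: "continuous_on S plane_point"
proof -
  have "plane_point = (\<lambda>p. \<chi> i. if i = 1 then fst p else snd p)"
    by (auto simp: vec_eq_iff fun_eq_iff forall_2 plane_point_def)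
  moreover have "continuous_on S (\<lambda>p. \<chi> i::2. if i = 1 then fst p else snd p)"
    by (rule continuous_on_vec_lambda, rename_tac i, case_tac "i = 1") (auto intro!: continuous_intros)
  ultimately show ?thesis by (simp only:)
qed

text \<open>A Borel measure that gives every open box its volume is Lebesgue measure. Under
  \<open>plane_point\<close> the preimage of a box is a product of two intervals.\<close>

lemma lborel_real2_eq_distr:
  "(lborel :: (real^2) measure) = distr (lborel \<Otimes>\<^sub>M lborel) borel plane_point"
proof (rule lborel_eqI)
  fix l u :: "real^2"
  assume le: "\<And>b. b \<in> Basis \<Longrightarrow> l \<bullet> b \<le> u \<bullet> b"
  have basis: "(Basis :: (real^2) set) = {axis 1 1, axis 2 1}"
    by (auto simp: Basis_vec_def UNIV_2)
  have lu: "l $ 1 \<le> u $ 1" "l $ 2 \<le> u $ 2"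
    using le[of "axis 1 1"] le[of "axis 2 1"] by (auto simp: basis inner_axis)
  have "plane_point \<in> borel_measurable borel"
    by (intro borel_measurable_continuous_onI continuous_on_plane_point)
  then have m: "plane_point \<in> borel_measurable (lborel \<Otimes>\<^sub>M lborel)"
    by (simp add: lborel_prod)
  have "plane_point -` box l u = {l $ 1<..<u $ 1} \<times> {l $ 2<..<u $ 2}"
    by (auto simp: mem_box_cart forall_2)
  then have "emeasure (distr (lborel \<Otimes>\<^sub>M lborel) borel plane_point) (box l u)
    = emeasure (lborel \<Otimes>\<^sub>M lborel) ({l $ 1<..<u $ 1} \<times> {l $ 2<..<u $ 2})"
    using m by (subst emeasure_distr) (auto simp: space_pair_measure)
  also have "\<dots> = ennreal (u $ 1 - l $ 1) * ennreal (u $ 2 - l $ 2)"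
    using lu by (simp add: lborel.emeasure_pair_measure_Times)
  also have "\<dots> = (\<Prod>b\<in>Basis. (u - l) \<bullet> b)"
    using lu by (simp add: basis axis_eq_axis inner_axis ennreal_mult)
  finally show "emeasure (distr (lborel \<Otimes>\<^sub>M lborel) borel plane_point) (box l u)
    = (\<Prod>b\<in>Basis. (u - l) \<bullet> b)" .
qed simp

text \<open>The measure of \<open>K\<close> is the integral of the measures of its vertical
  sections, so it would vanish if all of them were null.\<close>

lemma vertical_section_nonnull:
  fixes K :: "(real^2) set"
  assumes "K \<in> sets borel" "emeasure lborel K \<noteq> 0"
  obtains x where "emeasure lborel {y. plane_point (x, y) \<in> K} \<noteq> 0"
proof -
  have "plane_point \<in> borel_measurable borel"
    by (intro borel_measurable_continuous_onI continuous_on_plane_point)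
  then have m: "plane_point \<in> borel_measurable (lborel \<Otimes>\<^sub>M lborel)"
    by (simp add: lborel_prod)
  have s: "plane_point -` K \<in> sets (lborel \<Otimes>\<^sub>M lborel)"
    using measurable_sets[OF m assms(1)] by (simp add: space_pair_measure)
  have "emeasure lborel K = emeasure (lborel \<Otimes>\<^sub>M lborel) (plane_point -` K)"
    using assms(1) m by (subst lborel_real2_eq_distr, subst emeasure_distr) (auto simp: space_pair_measure)
  also have "\<dots> = (\<integral>\<^sup>+ x. emeasure lborel (Pair x -` plane_point -` K) \<partial>lborel)"
    by (rule lborel.emeasure_pair_measure_alt[OF s])
  finally have "\<exists>x. emeasure lborel (Pair x -` plane_point -` K) \<noteq> 0"
    using assms(2) by (intro ccontr[of "\<exists>x. _ x"]) simp
  then show thesis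
    using that by (auto simp: vimage_def)
qed

section \<open>Avoiding fewer than continuum many circles\<close>

lemma finite_vertical_circle_section: "finite {y. dist (plane_point (x, y)) p = q}"
proof (rule finite_subset)
  let ?s = "sqrt (q\<^sup>2 - (x - p $ 1)\<^sup>2)"
  show "{y. dist (plane_point (x, y)) p = q} \<subseteq> {p $ 2 + ?s, p $ 2 - ?s}"
  proof
    fix y assume "y \<in> {y. dist (plane_point (x, y)) p = q}"
    then have "q\<^sup>2 = (x - p $ 1)\<^sup>2 + (y - p $ 2)\<^sup>2"
      by (auto simp: dist_vec_def L2_set_def sum_2 dist_real_def)
    then have "?s = \<bar>y - p $ 2\<bar>"
      by simp
    then show "y \<in> {p $ 2 + ?s, p $ 2 - ?s}"
      by auto
  qed
qed auto

lemma exists_point_irrational_distances: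
  fixes K S :: "(real^2) set"
  assumes "closed K" "emeasure lborel K \<noteq> 0" "|S| <o |UNIV :: real set|"
  shows "\<exists>x\<in>K. \<forall>y\<in>S. dist x y \<notin> \<rat>"
proof -
  obtain x where x: "emeasure lborel {y. plane_point (x, y) \<in> K} \<noteq> 0"
    using vertical_section_nonnull[OF borel_closed[OF assms(1)] assms(2)] .
  define T where "T = {y. plane_point (x, y) \<in> K}"
  \<comment> \<open>The forbidden heights on the line: those at rational distance from some point of
    \<open>S\<close>.\<close>
  define Z where "Z = (\<Union>p\<in>S. \<Union>q\<in>\<rat>. {y. dist (plane_point (x, y)) p = q})"
  have "closed T"
    unfolding T_def
    by (rule closed_vimage[OF assms(1), of "\<lambda>y. plane_point (x, y)", unfolded vimage_def])
       (intro continuous_on_compose2[OF continuous_on_plane_point[of UNIV]] continuous_intros subset_UNIV)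
  \<comment> \<open>The section is closed but may be unbounded, whereas the cardinality bound is for
    compact sets. Some truncation is non-null, since countably many null pieces would make
    \<open>T\<close> null.\<close>
  have "\<exists>n::nat. emeasure lborel (T \<inter> {- real n..real n}) \<noteq> 0"
  proof (rule ccontr)
    assume "\<not> ?thesis"
    then have "(\<Union>n::nat. T \<inter> {- real n..real n}) \<in> null_sets lborel"
      using \<open>closed T\<close> by (intro null_sets_UN) (auto simp: null_sets_def)
    moreover have "(\<Union>n::nat. T \<inter> {- real n..real n}) = T"
    proof -
      have "\<exists>n::nat. - real n \<le> y \<and> y \<le> real n" for y
        using real_arch_simple[of "\<bar>y\<bar>"] by (auto simp: abs_le_iff minus_le_iff)
      then show ?thesis by auto
    qed
    ultimately show False
      using x by (simp add: T_def null_sets_def)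
  qed
  then obtain n :: nat where "emeasure lborel (T \<inter> {- real n..real n}) \<noteq> 0" ..
  then have "|UNIV :: real set| \<le>o |T \<inter> {- real n..real n}|"
    using \<open>closed T\<close> by (intro card_of_real_ordLeq_compact closed_Int_compact) auto
  also have "|T \<inter> {- real n..real n}| \<le>o |T|"
    by (rule card_of_mono1) auto
  finally have big: "|UNIV :: real set| \<le>o |T|" .
  have "|UNIV :: nat set| <o |UNIV :: real set|"
  proof -
    have "\<not> (\<exists>f :: real \<Rightarrow> nat. inj_on f UNIV \<and> range f \<subseteq> UNIV)"
      using uncountable_UNIV_real by (auto simp: countable_def)
    then show ?thesis
      by (simp only: card_of_ordLess)
  qed
  \<comment> \<open>\<open>S\<close> may be finite. Adding a copy of the naturals gives an infinite
    cardinal, still below the continuum, that bounds both the index set \<open>S\<close> and the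
    countable set forbidden by each point.\<close>
  then have less: "|S <+> (UNIV :: nat set)| <o |UNIV :: real set|"
    using assms(3) by (intro card_of_Plus_ordLess_infinite) (auto simp: infinite_UNIV_char_0)
  have "|Z| \<le>o |S <+> (UNIV :: nat set)|"
    unfolding Z_def
  proof (rule card_of_UNION_ordLeq_infinite)
    show "|S| \<le>o |S <+> (UNIV :: nat set)|"
      by (rule card_of_Plus1)
    have "countable (\<Union>q\<in>\<rat>. {y. dist (plane_point (x, y)) p = q})" for p
      by (intro countable_UN countable_rat countable_finite finite_vertical_circle_section)
    then have "|\<Union>q\<in>\<rat>. {y. dist (plane_point (x, y)) p = q}| \<le>o |UNIV :: nat set|" for p
      by (meson card_of_ordLeq countableE subset_UNIV)
    then show "\<forall>p\<in>S. |\<Union>q\<in>\<rat>. {y. dist (plane_point (x, y)) p = q}| \<le>o |S <+> (UNIV :: nat set)|"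
      using card_of_Plus2 ordLeq_transitive by blast
  qed auto
  then have "|Z| <o |T|"
    using less big ordLeq_ordLess_trans ordLess_ordLeq_trans by blast
  then have "\<not> T \<subseteq> Z"
    using card_of_mono1 not_ordLess_ordLeq by blast
  then show ?thesis
    unfolding T_def Z_def by blast
qed

section \<open>Fullness of the transversal\<close>

theorem theorem3p1:
  fixes A :: "(real^2) set"
  assumes "A \<in> sets lebesgue" and "emeasure lebesgue A > 0"
  shows "\<exists>B. B \<subseteq> A \<and> avoids_rational_distances B \<and> full_in B A"
proof -
  define C where "C = {K. closed K \<and> K \<subseteq> A \<and> emeasure lborel K \<noteq> 0}"
  have card: "|C| \<le>o |UNIV :: real set|"
    by (rule card_of_closed_sets_ordLeq) (auto simp: C_def)
  obtain f where f: "\<And>K. K \<in> C \<Longrightarrow> f K \<in> K"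
    "\<And>K L. K \<in> C \<Longrightarrow> L \<in> C \<Longrightarrow> K \<noteq> L \<Longrightarrow> dist (f K) (f L) \<notin> \<rat> \<or> dist (f L) (f K) \<notin> \<rat>"
  proof (rule transfinite_transversal[of C "\<lambda>x y. dist x y \<notin> \<rat>"])
    show "\<exists>x\<in>K. \<forall>y\<in>S. dist x y \<notin> \<rat>" if "K \<in> C" "|S| <o |C|" for K S
      using that card
      by (intro exists_point_irrational_distances) (auto simp: C_def intro: ordLess_ordLeq_trans)
  qed blast
  define B where "B = f ` C"
  have "B \<subseteq> A"
    using f(1) by (auto simp: B_def C_def)
  have "avoids_rational_distances B"
    unfolding avoids_rational_distances_def
  proof (intro ballI impI)
    fix x y assume "x \<in> B" "y \<in> B" "x \<noteq> y"
    then obtain K L where "K \<in> C" "L \<in> C" "K \<noteq> L" "x = f K" "y = f L"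
      by (auto simp: B_def)
    then show "dist x y \<notin> \<rat>"
      using f(2)[of K L] by (simp add: dist_commute)
  qed
  \<comment> \<open>Any measurable \<open>Y\<close> covering \<open>X \<inter> B\<close> covers
    \<open>X \<inter> A\<close> up to a null set: otherwise the uncovered part contains a member of
    \<open>C\<close>, whose chosen point lies in \<open>X \<inter> B\<close> but not in
    \<open>Y\<close>.\<close>
  have "outer_measure_of lebesgue (X \<inter> A) \<le> outer_measure_of lebesgue (X \<inter> B)"
    if X: "X \<in> sets lebesgue" for X
    unfolding outer_measure_of_def[of _ "X \<inter> B"]
  proof (rule INF_greatest)
    fix Y assume "Y \<in> {Y \<in> sets lebesgue. X \<inter> B \<subseteq> Y}"
    then have Y: "Y \<in> sets lebesgue" "X \<inter> B \<subseteq> Y"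
      by auto
    let ?D = "X \<inter> A - Y"
    have D: "?D \<in> sets lebesgue"
      using X Y assms(1) by blast
    have "emeasure lebesgue ?D = 0"
    proof (rule ccontr)
      assume nz: "emeasure lebesgue ?D \<noteq> 0"
      \<comment> \<open>The measure of \<open>?D\<close> may be infinite, so a finite positive lower
        bound \<open>e\<close> is taken. A closed subset that misses less than \<open>e\<close> of
        \<open>?D\<close> cannot be null.\<close>
      obtain e where e: "e > 0" "ennreal e \<le> emeasure lebesgue ?D"
      proof (cases "emeasure lebesgue ?D")
        case (real r)
        then show thesis using nz that[of r] by (cases "r = 0") auto
      next
        case top
        then show thesis using that[of 1] by auto
      qed
      obtain T where T: "closed T" "T \<subseteq> ?D" "emeasure lebesgue (?D - T) < ennreal e"
        using sets_lebesgue_inner_closed[OF D e(1)] .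
      have "emeasure lborel T \<noteq> 0"
      proof
        assume "emeasure lborel T = 0"
        then have "T \<in> null_sets lebesgue"
          using T(1) by (auto simp: null_sets_def)
        then have "emeasure lebesgue (?D - T) = emeasure lebesgue ?D"
          using D by (rule emeasure_Diff_null_set)
        then show False
          using T(3) e(2) by auto
      qed
      then have "T \<in> C"
        using T by (auto simp: C_def)
      then have "f T \<in> T" "f T \<in> B"
        using f(1) by (auto simp: B_def)
      then show False
        using T(2) Y(2) by auto
    qed
    then have "?D \<in> null_sets lebesgue"
      using D by auto
    have "emeasure lebesgue (X \<inter> A) \<le> emeasure lebesgue (Y \<union> ?D)"
      using D Y(1) by (intro emeasure_mono sets.Un) auto
    also have "\<dots> = emeasure lebesgue Y"
      using Y(1) \<open>?D \<in> null_sets lebesgue\<close> by (rule emeasure_Un_null_set)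
    finally show "outer_measure_of lebesgue (X \<inter> A) \<le> emeasure lebesgue Y"
      using X assms(1) by (simp add: outer_measure_of_eq)
  qed
  moreover have "outer_measure_of lebesgue (X \<inter> B) \<le> outer_measure_of lebesgue (X \<inter> A)" for X
    using \<open>B \<subseteq> A\<close> by (intro outer_measure_of_mono) auto
  ultimately have "full_in B A"
    using \<open>B \<subseteq> A\<close> by (auto simp: full_in_def intro: antisym)
  then show ?thesis
    using \<open>B \<subseteq> A\<close> \<open>avoids_rational_distances B\<close> by blast
qed

end
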